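(* Let $G$ be a Lie group acting transitively on a manifold $M$, let a stage tree be given, and consider motions, the skeleton $\Sigma$ they define, and an isotropy map $\varpi$. Then: (i) if the motions have the form $\Psi_{i,j}=\Psi\circ\theta_{i,j}$ for a motion map $\Psi$ and transition functions $\theta_{i,j}$, and if $\Psi$ and all the $\theta_{i,j}$ are local, then so are the motions $\Psi_{i,j}$; (ii) if all the motions $\Psi_{i,j}$ are local, then so is the corresponding skeleton $\Sigma$; (iii) if the skeleton $\Sigma$ and the isotropy map $\varpi$ are local, then so is the method $\Phi=\Sigma\circ\varpi$.
   Context: Setting: $G$ is a Lie group with Lie algebra $\mathfrak g$, acting smoothly and transitively on a smooth manifold $M$; the action is written $g\cdot x$, and $\xi\cdot x\in T_xM$ is the infinitesimal action of $\xi\in\mathfrak g$. Isotropy map: a linear map $\varpi\colon\mathfrak X(M)\to C^\infty(M,\mathfrak g)$, $f\mapsto\langle\varpi,f\rangle$, where $\mathfrak X(M)$ is the space of vector fields, such that $\langle\varpi,f\rangle(x)\cdot x=f(x)$ for all $x$ and $f$. The support of $\nu\in C^\infty(M,\mathfrak g)$ or of a vector field is the closure of the set where it is nonzero. The isotropy map $\varpi$ is local if $\operatorname{supp}\langle\varpi,f\rangle\subset\operatorname{supp} f$ for all $f\in\mathfrak X(M)$. Skeleton: a stage tree is a finite tree (connected undirected graph without cycles) with $n$ vertices, two of which are singled out: the initial vertex $\circ$ and the final vertex $\bullet$. Motions are maps $\Psi_{i,j}\colon\mathfrak g^n\to G$, one for each ordered pair of adjacent vertices, with $\Psi_{i,j}(F)=\Psi_{j,i}(F)^{-1}$.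 Given $\nu\in C^\infty(M,\mathfrak g)$ and $x_0\in M$, the point $x_1=\Sigma(\nu)(x_0)$ is defined by the system: $X_\circ=x_0$; $X_i=\Psi_{i,j}(F)\cdot X_j$ for every edge $i,j$; $F_i=\nu(X_i)$ for every vertex $i$; $x_1=X_\bullet$, with unknowns $X_i\in M$, $F_i\in\mathfrak g$. Standing assumption: $\nu$ is always scaled so that this system has exactly one solution and $\Sigma(\nu)$ is a diffeomorphism. The map $\nu\mapsto\Sigma(\nu)$ is the skeleton. A motion map is a map $\Psi\colon\mathfrak g\to G$ with $\Psi(-\xi)=\Psi(\xi)^{-1}$; transition functions are maps $\theta_{i,j}\colon\mathfrak g^n\to\mathfrak g$, for adjacent $i,j$, with $\theta_{i,j}=-\theta_{j,i}$. Locality: $\Psi$ is local if $\Psi(0)=\mathrm{Id}$; the motions are local if $\Psi_{i,j}(0)=\mathrm{Id}$; the transition functions are local if $\theta_{i,j}(0)=0$. The support of a diffeomorphism $\varphi$ of $M$ is the closure of $\{x : \varphi(x)\neq x\}$. The skeleton $\Sigma$ is local if $\operatorname{supp}\Sigma(\nu)\subset\operatorname{supp}\nu$ for all $\nu$; a method $\Phi$ (a map from vector fields to diffeomorphisms) is local if $\operatorname{supp}\Phi(f)\subset\operatorname{supp} f$ for all $f$. The method $\Phi=\Sigma\circ\varpi$ is $\Phi(f)=\Sigma(\langle\varpi,f\rangle)$. *)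

theory Defs
  imports
    "HOL-Analysis.Analysis"
    "HOL-Algebra.Group_Action"
    "HOL-Library.Function_Algebras"
begin

section \<open>Smooth manifolds\<close>

text \<open>
  Model spaces are arbitrary finite-dimensional real normed spaces rather than members of
  the class \<open>euclidean_space\<close>, because that class excludes dimension zero (discrete
  groups, one-point manifolds).
\<close>

primrec C_k_on :: "nat \<Rightarrow> 'a::real_normed_vector set \<Rightarrow> ('a \<Rightarrow> 'b::real_normed_vector) \<Rightarrow> bool" where
  "C_k_on 0 S f \<longleftrightarrow> continuous_on S f"
| "C_k_on (Suc k) S f \<longleftrightarrow>
     (\<forall>x\<in>S. f differentiable (at x)) \<and> (\<forall>v. C_k_on k S (\<lambda>x. frechet_derivative f (at x) v))"

text \<open>To be used for open sets in finite-dimensional spaces only.\<close>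

definition smooth_on :: "'a::real_normed_vector set \<Rightarrow> ('a \<Rightarrow> 'b::real_normed_vector) \<Rightarrow> bool" where
  "smooth_on S f \<longleftrightarrow> (\<forall>k. C_k_on k S f)"

type_synonym ('m, 'e) atlas = "('m set \<times> ('m \<Rightarrow> 'e)) set"

definition smooth_manifold ::
  "('m::{t2_space, second_countable_topology}, 'e::real_normed_vector) atlas \<Rightarrow> bool" where
  "smooth_manifold A \<longleftrightarrow>
     (\<exists>B::'e set. finite B \<and> span B = UNIV) \<and>
     (\<Union>(U, \<phi>)\<in>A. U) = UNIV \<and>
     (\<forall>(U, \<phi>)\<in>A. open U \<and> open (\<phi> ` U) \<and> homeomorphism U (\<phi> ` U) \<phi> (inv_into U \<phi>)) \<and>
     (\<forall>(U, \<phi>)\<in>A. \<forall>(V, \<psi>)\<in>A. smooth_on (\<phi> ` (U \<inter> V)) (\<psi> \<circ> inv_into U \<phi>))"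

definition smooth_map ::
  "('m::topological_space, 'e::real_normed_vector) atlas \<Rightarrow>
   ('n::topological_space, 'f::real_normed_vector) atlas \<Rightarrow> ('m \<Rightarrow> 'n) \<Rightarrow> bool" where
  "smooth_map A B f \<longleftrightarrow> continuous_on UNIV f \<and>
     (\<forall>(U, \<phi>)\<in>A. \<forall>(V, \<psi>)\<in>B. smooth_on (\<phi> ` (U \<inter> f -` V)) (\<psi> \<circ> f \<circ> inv_into U \<phi>))"

definition prod_atlas :: "('m, 'e) atlas \<Rightarrow> ('n, 'f) atlas \<Rightarrow> ('m \<times> 'n, 'e \<times> 'f) atlas" where
  "prod_atlas A B = {(U \<times> V, map_prod \<phi> \<psi>) | U \<phi> V \<psi>. (U, \<phi>) \<in> A \<and> (V, \<psi>) \<in> B}"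

definition diffeomorphism ::
  "('m::topological_space, 'e::real_normed_vector) atlas \<Rightarrow> ('m \<Rightarrow> 'm) \<Rightarrow> bool" where
  "diffeomorphism A f \<longleftrightarrow> bij f \<and> smooth_map A A f \<and> smooth_map A A (inv_into UNIV f)"

definition smooth_functions ::
  "('m::topological_space, 'e::real_normed_vector) atlas \<Rightarrow> ('m \<Rightarrow> real) set" where
  "smooth_functions A = {h. smooth_map A {(UNIV, \<lambda>r::real. r)} h}"

text \<open>
  Tangent vectors are point derivations of the algebra of smooth functions. They are made
  extensional (zero on functions that are not smooth), so that equality of tangent vectors
  is equality of functions, and zero and negation are the pointwise ones.
\<close>

type_synonym 'm tangent = "('m \<Rightarrow> real) \<Rightarrow> real"

definition tangent_space ::
  "('m::topological_space, 'e::real_normed_vector) atlas \<Rightarrow> 'm \<Rightarrow> 'm tangent set" where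
  "tangent_space A x = {v.
     (\<forall>h\<in>smooth_functions A. \<forall>k\<in>smooth_functions A.
        (\<forall>a b. v (\<lambda>y. a * h y + b * k y) = a * v h + b * v k) \<and>
        v (\<lambda>y. h y * k y) = h x * v k + k x * v h) \<and>
     (\<forall>h. h \<notin> smooth_functions A \<longrightarrow> v h = 0)}"

definition vector_fields ::
  "('m::topological_space, 'e::real_normed_vector) atlas \<Rightarrow> ('m \<Rightarrow> 'm tangent) set" where
  "vector_fields A = {f. (\<forall>x. f x \<in> tangent_space A x) \<and>
     (\<forall>h\<in>smooth_functions A. (\<lambda>x. f x h) \<in> smooth_functions A)}"

definition support :: "('m::topological_space \<Rightarrow> 'b::zero) \<Rightarrow> 'm set" where
  "support u = closure {x. u x \<noteq> 0}"

definition diffeo_support :: "('m::topological_space \<Rightarrow> 'm) \<Rightarrow> 'm set" where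
  "diffeo_support \<phi> = closure {x. \<phi> x \<noteq> x}"


section \<open>Lie groups and transitive actions\<close>

definition lie_group ::
  "'g::{t2_space, second_countable_topology} monoid \<Rightarrow> ('g, 'h::real_normed_vector) atlas \<Rightarrow> bool" where
  "lie_group G AG \<longleftrightarrow> group G \<and> carrier G = UNIV \<and> smooth_manifold AG \<and>
     smooth_map (prod_atlas AG AG) AG (\<lambda>(x, y). x \<otimes>\<^bsub>G\<^esub> y) \<and>
     smooth_map AG AG (\<lambda>x. inv\<^bsub>G\<^esub> x)"

text \<open>The Lie bracket is never needed, only the vector space structure.\<close>

definition lie_algebra ::
  "'g::topological_space monoid \<Rightarrow> ('g, 'h::real_normed_vector) atlas \<Rightarrow> 'g tangent set" where
  "lie_algebra G AG = tangent_space AG \<one>\<^bsub>G\<^esub>"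

definition smooth_transitive_action ::
  "'g::{t2_space, second_countable_topology} monoid \<Rightarrow> ('g, 'h::real_normed_vector) atlas \<Rightarrow>
   ('m::{t2_space, second_countable_topology}, 'e::real_normed_vector) atlas \<Rightarrow>
   ('g \<Rightarrow> 'm \<Rightarrow> 'm) \<Rightarrow> bool" where
  "smooth_transitive_action G AG AM act \<longleftrightarrow>
     lie_group G AG \<and> smooth_manifold AM \<and> transitive_action G UNIV act \<and>
     smooth_map (prod_atlas AG AM) AM (\<lambda>(g, x). act g x)"

text \<open>
  \<open>\<xi> \<cdot> x\<close> is the image of \<open>\<xi>\<close> under the differential at the identity of the orbit map
  \<open>g \<mapsto> g \<cdot> x\<close>.
\<close>

definition infinitesimal_action ::
  "('m::topological_space, 'e::real_normed_vector) atlas \<Rightarrow> ('g \<Rightarrow> 'm \<Rightarrow> 'm) \<Rightarrow>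
   'g tangent \<Rightarrow> 'm \<Rightarrow> 'm tangent" where
  "infinitesimal_action AM act \<xi> x =
     (\<lambda>h. if h \<in> smooth_functions AM then \<xi> (\<lambda>g. h (act g x)) else 0)"

text \<open>
  Smoothness of a map into the Lie algebra, a finite-dimensional vector space: smoothness of
  its components with respect to finitely many elements of the Lie algebra.
\<close>

definition smooth_lie_maps ::
  "'g::topological_space monoid \<Rightarrow> ('g, 'h::real_normed_vector) atlas \<Rightarrow>
   ('m::topological_space, 'e::real_normed_vector) atlas \<Rightarrow> ('m \<Rightarrow> 'g tangent) set" where
  "smooth_lie_maps G AG AM = {\<nu>. (\<forall>x. \<nu> x \<in> lie_algebra G AG) \<and>
     (\<exists>B c. finite B \<and> B \<subseteq> lie_algebra G AG \<and> (\<forall>\<xi>\<in>B. c \<xi> \<in> smooth_functions AM) \<and>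
        (\<forall>x. \<nu> x = (\<lambda>h. \<Sum>\<xi>\<in>B. c \<xi> x * \<xi> h)))}"

definition isotropy_map ::
  "'g::topological_space monoid \<Rightarrow> ('g, 'h::real_normed_vector) atlas \<Rightarrow>
   ('m::topological_space, 'e::real_normed_vector) atlas \<Rightarrow> ('g \<Rightarrow> 'm \<Rightarrow> 'm) \<Rightarrow>
   (('m \<Rightarrow> 'm tangent) \<Rightarrow> ('m \<Rightarrow> 'g tangent)) \<Rightarrow> bool" where
  "isotropy_map G AG AM act \<omega> \<longleftrightarrow>
     (\<forall>f\<in>vector_fields AM. \<omega> f \<in> smooth_lie_maps G AG AM) \<and>
     (\<forall>f\<in>vector_fields AM. \<forall>f'\<in>vector_fields AM. \<forall>a b.
        \<omega> (\<lambda>x h. a * f x h + b * f' x h) = (\<lambda>x h. a * \<omega> f x h + b * \<omega> f' x h)) \<and>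
     (\<forall>f\<in>vector_fields AM. \<forall>x. infinitesimal_action AM act (\<omega> f x) x = f x)"

definition local_isotropy_map ::
  "('m::topological_space, 'e::real_normed_vector) atlas \<Rightarrow>
   (('m \<Rightarrow> 'm tangent) \<Rightarrow> ('m \<Rightarrow> 'g tangent)) \<Rightarrow> bool" where
  "local_isotropy_map AM \<omega> \<longleftrightarrow> (\<forall>f\<in>vector_fields AM. support (\<omega> f) \<subseteq> support f)"


section \<open>Skeletons\<close>

text \<open>
  The vertices are all elements of a finite type; \<open>E\<close> is the adjacency relation,
  \<open>s\<close> the initial and \<open>t\<close> the final vertex.
\<close>

definition stage_tree :: "('v::finite \<Rightarrow> 'v \<Rightarrow> bool) \<Rightarrow> 'v \<Rightarrow> 'v \<Rightarrow> bool" where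
  "stage_tree E s t \<longleftrightarrow> symp E \<and> irreflp E \<and> (\<forall>i j. E\<^sup>*\<^sup>* i j) \<and>
     \<not> (\<exists>p. length p \<ge> 3 \<and> distinct p \<and> successively E p \<and> E (last p) (hd p)) \<and> s \<noteq> t"

text \<open>Values of \<open>\<Psi> i j\<close> for \<open>i\<close>, \<open>j\<close> not adjacent are irrelevant.\<close>

definition motions ::
  "'g::topological_space monoid \<Rightarrow> ('g, 'h::real_normed_vector) atlas \<Rightarrow> ('v \<Rightarrow> 'v \<Rightarrow> bool) \<Rightarrow>
   ('v \<Rightarrow> 'v \<Rightarrow> ('v \<Rightarrow> 'g tangent) \<Rightarrow> 'g) \<Rightarrow> bool" where
  "motions G AG E \<Psi> \<longleftrightarrow>
     (\<forall>i j. E i j \<longrightarrow> (\<forall>F \<in> UNIV \<rightarrow> lie_algebra G AG. \<Psi> i j F = inv\<^bsub>G\<^esub> (\<Psi> j i F)))"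

definition motion_map ::
  "'g::topological_space monoid \<Rightarrow> ('g, 'h::real_normed_vector) atlas \<Rightarrow>
   ('g tangent \<Rightarrow> 'g) \<Rightarrow> bool" where
  "motion_map G AG \<psi> \<longleftrightarrow> (\<forall>\<xi>\<in>lie_algebra G AG. \<psi> (- \<xi>) = inv\<^bsub>G\<^esub> (\<psi> \<xi>))"

definition transition_functions ::
  "'g::topological_space monoid \<Rightarrow> ('g, 'h::real_normed_vector) atlas \<Rightarrow> ('v \<Rightarrow> 'v \<Rightarrow> bool) \<Rightarrow>
   ('v \<Rightarrow> 'v \<Rightarrow> ('v \<Rightarrow> 'g tangent) \<Rightarrow> 'g tangent) \<Rightarrow> bool" where
  "transition_functions G AG E \<theta> \<longleftrightarrow>
     (\<forall>i j. E i j \<longrightarrow> (\<forall>F \<in> UNIV \<rightarrow> lie_algebra G AG.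
        \<theta> i j F \<in> lie_algebra G AG \<and> \<theta> i j F = - \<theta> j i F))"

definition local_motion_map :: "'g monoid \<Rightarrow> ('g tangent \<Rightarrow> 'g) \<Rightarrow> bool" where
  "local_motion_map G \<psi> \<longleftrightarrow> \<psi> 0 = \<one>\<^bsub>G\<^esub>"

definition local_transition_functions ::
  "('v \<Rightarrow> 'v \<Rightarrow> bool) \<Rightarrow> ('v \<Rightarrow> 'v \<Rightarrow> ('v \<Rightarrow> 'g tangent) \<Rightarrow> 'g tangent) \<Rightarrow> bool" where
  "local_transition_functions E \<theta> \<longleftrightarrow> (\<forall>i j. E i j \<longrightarrow> \<theta> i j (\<lambda>_. 0) = 0)"

definition local_motions ::
  "'g monoid \<Rightarrow> ('v \<Rightarrow> 'v \<Rightarrow> bool) \<Rightarrow> ('v \<Rightarrow> 'v \<Rightarrow> ('v \<Rightarrow> 'g tangent) \<Rightarrow> 'g) \<Rightarrow> bool" where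
  "local_motions G E \<Psi> \<longleftrightarrow> (\<forall>i j. E i j \<longrightarrow> \<Psi> i j (\<lambda>_. 0) = \<one>\<^bsub>G\<^esub>)"

definition stage_system ::
  "('g \<Rightarrow> 'm \<Rightarrow> 'm) \<Rightarrow> ('v \<Rightarrow> 'v \<Rightarrow> bool) \<Rightarrow> 'v \<Rightarrow> ('v \<Rightarrow> 'v \<Rightarrow> ('v \<Rightarrow> 'g tangent) \<Rightarrow> 'g) \<Rightarrow>
   ('m \<Rightarrow> 'g tangent) \<Rightarrow> 'm \<Rightarrow> ('v \<Rightarrow> 'm) \<times> ('v \<Rightarrow> 'g tangent) \<Rightarrow> bool" where
  "stage_system act E s \<Psi> \<nu> x0 = (\<lambda>(X, F).
     X s = x0 \<and> (\<forall>i j. E i j \<longrightarrow> X i = act (\<Psi> i j F) (X j)) \<and> (\<forall>i. F i = \<nu> (X i)))"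

definition skeleton ::
  "('g \<Rightarrow> 'm \<Rightarrow> 'm) \<Rightarrow> ('v \<Rightarrow> 'v \<Rightarrow> bool) \<Rightarrow> 'v \<Rightarrow> 'v \<Rightarrow>
   ('v \<Rightarrow> 'v \<Rightarrow> ('v \<Rightarrow> 'g tangent) \<Rightarrow> 'g) \<Rightarrow> ('m \<Rightarrow> 'g tangent) \<Rightarrow> 'm \<Rightarrow> 'm" where
  "skeleton act E s t \<Psi> \<nu> x0 = fst (THE XF. stage_system act E s \<Psi> \<nu> x0 XF) t"

text \<open>
  The sufficiently scaled maps: those for which the system is uniquely solvable for every
  starting point and the skeleton yields a diffeomorphism. This set is the domain of the
  skeleton, and the vector fields that the isotropy map sends into it form the domain of the
  associated method.
\<close>

definition skeleton_domain ::
  "'g::topological_space monoid \<Rightarrow> ('g, 'h::real_normed_vector) atlas \<Rightarrow>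
   ('m::topological_space, 'e::real_normed_vector) atlas \<Rightarrow> ('g \<Rightarrow> 'm \<Rightarrow> 'm) \<Rightarrow>
   ('v \<Rightarrow> 'v \<Rightarrow> bool) \<Rightarrow> 'v \<Rightarrow> 'v \<Rightarrow> ('v \<Rightarrow> 'v \<Rightarrow> ('v \<Rightarrow> 'g tangent) \<Rightarrow> 'g) \<Rightarrow>
   ('m \<Rightarrow> 'g tangent) set" where
  "skeleton_domain G AG AM act E s t \<Psi> = {\<nu> \<in> smooth_lie_maps G AG AM.
     (\<forall>x0. \<exists>!XF. stage_system act E s \<Psi> \<nu> x0 XF) \<and>
     diffeomorphism AM (skeleton act E s t \<Psi> \<nu>)}"

definition method_domain ::
  "'g::topological_space monoid \<Rightarrow> ('g, 'h::real_normed_vector) atlas \<Rightarrow>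
   ('m::topological_space, 'e::real_normed_vector) atlas \<Rightarrow> ('g \<Rightarrow> 'm \<Rightarrow> 'm) \<Rightarrow>
   ('v \<Rightarrow> 'v \<Rightarrow> bool) \<Rightarrow> 'v \<Rightarrow> 'v \<Rightarrow> ('v \<Rightarrow> 'v \<Rightarrow> ('v \<Rightarrow> 'g tangent) \<Rightarrow> 'g) \<Rightarrow>
   (('m \<Rightarrow> 'm tangent) \<Rightarrow> ('m \<Rightarrow> 'g tangent)) \<Rightarrow> ('m \<Rightarrow> 'm tangent) set" where
  "method_domain G AG AM act E s t \<Psi> \<omega> =
     {f \<in> vector_fields AM. \<omega> f \<in> skeleton_domain G AG AM act E s t \<Psi>}"

text \<open>Locality of a skeleton or of a method, with domain \<open>D\<close>.\<close>

definition local_on ::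
  "('m::topological_space \<Rightarrow> 'b::zero) set \<Rightarrow> (('m \<Rightarrow> 'b) \<Rightarrow> ('m \<Rightarrow> 'm)) \<Rightarrow> bool" where
  "local_on D \<Phi> \<longleftrightarrow> (\<forall>u\<in>D. diffeo_support (\<Phi> u) \<subseteq> support u)"

end

theory Submission
  imports Defs
begin

text \<open>
  At a point where \<open>\<nu>\<close> vanishes, the stage system is solved by placing every stage at
  that point, because the motions are the identity there. By uniqueness this is the
  solution, so the skeleton fixes the point.
\<close>

text \<open>The factorisation of the motions through \<open>\<psi>\<close> and
  \<open>\<theta>\<close> is only assumed on families with values in the Lie algebra; this makes it
  available at the zero family.\<close>

lemma zero_in_lie_algebra: "0 \<in> lie_algebra G AG"
  by (simp add: lie_algebra_def tangent_space_def)

lemma act_one: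
  assumes "smooth_transitive_action G AG AM act"
  shows "act \<one>\<^bsub>G\<^esub> x = x"
proof -
  have "transitive_action G UNIV act"
    using assms by (simp add: smooth_transitive_action_def)
  then have "group_action G UNIV act"
    by (rule transitive_action.axioms(1))
  \<comment> \<open>An action is a homomorphism into the group of bijections, whose unit is the
    identity made extensional outside the set acted on. That set is \<open>UNIV\<close> here, so the
    restriction disappears pointwise.\<close>
  then have "restrict (\<lambda>y. y) UNIV = act \<one>\<^bsub>G\<^esub>"
    by (rule group_action.id_eq_one)
  from fun_cong[OF this, of x] show ?thesis
    by simp
qed

lemma local_motions_compose:
  assumes "\<forall>i j. E i j \<longrightarrow> (\<forall>F \<in> UNIV \<rightarrow> lie_algebra G AG. \<Psi> i j F = \<psi> (\<theta> i j F))"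
    and "local_motion_map G \<psi>" and "local_transition_functions E \<theta>"
  shows "local_motions G E \<Psi>"
  unfolding local_motions_def
proof (intro allI impI)
  fix i j
  assume "E i j"
  have "(\<lambda>_. 0) \<in> UNIV \<rightarrow> lie_algebra G AG"
    by (simp add: zero_in_lie_algebra)
  with assms(1) \<open>E i j\<close> have "\<Psi> i j (\<lambda>_. 0) = \<psi> (\<theta> i j (\<lambda>_. 0))"
    by blast
  also have "\<dots> = \<one>\<^bsub>G\<^esub>"
    using assms(2,3) \<open>E i j\<close> by (simp add: local_motion_map_def local_transition_functions_def)
  finally show "\<Psi> i j (\<lambda>_. 0) = \<one>\<^bsub>G\<^esub>" .
qed

text \<open>The second component is the zero family because each \<open>F i\<close> equals
  \<open>\<nu> x\<close>; it is exactly the argument at which local motions are the identity, so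
  every edge equation becomes \<open>x = x\<close>.\<close>

lemma stage_system_constant:
  assumes "smooth_transitive_action G AG AM act" and "local_motions G E \<Psi>" and "\<nu> x = 0"
  shows "stage_system act E s \<Psi> \<nu> x (\<lambda>_. x, \<lambda>_. 0)"
  using assms by (simp add: stage_system_def local_motions_def act_one)

lemma skeleton_fixed_point:
  assumes "smooth_transitive_action G AG AM act" and "local_motions G E \<Psi>"
    and "\<exists>!XF. stage_system act E s \<Psi> \<nu> x XF" and "\<nu> x = 0"
  shows "skeleton act E s t \<Psi> \<nu> x = x"
  \<comment> \<open>Uniqueness evaluates the definite description in \<open>skeleton\<close> to the
    constant solution, whose value at the final vertex is \<open>x\<close>.\<close>
  using the1_equality[OF assms(3) stage_system_constant[where \<nu> = \<nu>, OF assms(1,2,4)]]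
  by (simp add: skeleton_def)

lemma local_on_skeleton:
  assumes "smooth_transitive_action G AG AM act" and "local_motions G E \<Psi>"
  shows "local_on (skeleton_domain G AG AM act E s t \<Psi>) (skeleton act E s t \<Psi>)"
  unfolding local_on_def diffeo_support_def support_def
\<comment> \<open>Both supports are closures, so by monotonicity it suffices to compare the sets
  themselves: a point that is moved cannot be a zero of \<open>\<nu>\<close>.\<close>
proof (intro ballI closure_mono subsetI CollectI notI)
  fix \<nu> x
  assume "\<nu> \<in> skeleton_domain G AG AM act E s t \<Psi>" and "\<nu> x = 0"
    and "x \<in> {x. skeleton act E s t \<Psi> \<nu> x \<noteq> x}"
  then show False
    using skeleton_fixed_point[OF assms, of s \<nu> x] by (simp add: skeleton_domain_def)
qed

text \<open>The two support inclusions chain through \<open>support (\<omega> f)\<close>. Membership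
  in \<open>method_domain\<close> serves both: it places \<open>\<omega> f\<close> in the domain of
  the skeleton and makes \<open>f\<close> a vector field.\<close>

lemma local_on_method:
  assumes "local_on (skeleton_domain G AG AM act E s t \<Psi>) (skeleton act E s t \<Psi>)"
    and "local_isotropy_map AM \<omega>"
  shows "local_on (method_domain G AG AM act E s t \<Psi> \<omega>) (skeleton act E s t \<Psi> \<circ> \<omega>)"
  unfolding local_on_def
proof
  fix f
  assume f: "f \<in> method_domain G AG AM act E s t \<Psi> \<omega>"
  then have "diffeo_support (skeleton act E s t \<Psi> (\<omega> f)) \<subseteq> support (\<omega> f)"
    using assms(1) by (simp add: local_on_def method_domain_def)
  also have "\<dots> \<subseteq> support f"
    using f assms(2) by (simp add: local_isotropy_map_def method_domain_def)
  finally show "diffeo_support ((skeleton act E s t \<Psi> \<circ> \<omega>) f) \<subseteq> support f"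
    by simp
qed

theorem proposition3p5:
  fixes G :: "'g::{t2_space, second_countable_topology} monoid"
    and AG :: "('g, 'h::real_normed_vector) atlas"
    and AM :: "('m::{t2_space, second_countable_topology}, 'e::real_normed_vector) atlas"
    and act :: "'g \<Rightarrow> 'm \<Rightarrow> 'm"
    and E :: "'v::finite \<Rightarrow> 'v \<Rightarrow> bool"
    and s t :: 'v
    and \<Psi> :: "'v \<Rightarrow> 'v \<Rightarrow> ('v \<Rightarrow> 'g tangent) \<Rightarrow> 'g"
    and \<omega> :: "('m \<Rightarrow> 'm tangent) \<Rightarrow> ('m \<Rightarrow> 'g tangent)"
  assumes "smooth_transitive_action G AG AM act"
    and "stage_tree E s t"
    and "motions G AG E \<Psi>"
    and "isotropy_map G AG AM act \<omega>"
  shows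
    "(\<forall>\<psi> \<theta>. motion_map G AG \<psi> \<and> transition_functions G AG E \<theta> \<and>
        (\<forall>i j. E i j \<longrightarrow> (\<forall>F \<in> UNIV \<rightarrow> lie_algebra G AG. \<Psi> i j F = \<psi> (\<theta> i j F))) \<and>
        local_motion_map G \<psi> \<and> local_transition_functions E \<theta>
        \<longrightarrow> local_motions G E \<Psi>) \<and>
     (local_motions G E \<Psi>
        \<longrightarrow> local_on (skeleton_domain G AG AM act E s t \<Psi>) (skeleton act E s t \<Psi>)) \<and>
     (local_on (skeleton_domain G AG AM act E s t \<Psi>) (skeleton act E s t \<Psi>) \<and>
        local_isotropy_map AM \<omega>
        \<longrightarrow> local_on (method_domain G AG AM act E s t \<Psi> \<omega>) (skeleton act E s t \<Psi> \<circ> \<omega>))"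
proof (intro conjI allI impI; (elim conjE)?)
  fix \<psi> \<theta>
  assume "motion_map G AG \<psi>" and "transition_functions G AG E \<theta>"
  assume "\<forall>i j. E i j \<longrightarrow> (\<forall>F \<in> UNIV \<rightarrow> lie_algebra G AG. \<Psi> i j F = \<psi> (\<theta> i j F))"
    and "local_motion_map G \<psi>" and "local_transition_functions E \<theta>"
  from local_motions_compose[where \<psi> = \<psi> and \<theta> = \<theta>, OF this]
  show "local_motions G E \<Psi>" .
next
  assume "local_motions G E \<Psi>"
  with assms(1) show "local_on (skeleton_domain G AG AM act E s t \<Psi>) (skeleton act E s t \<Psi>)"
    by (rule local_on_skeleton)
next
  assume "local_on (skeleton_domain G AG AM act E s t \<Psi>) (skeleton act E s t \<Psi>)"
    and "local_isotropy_map AM \<omega>"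
  then show "local_on (method_domain G AG AM act E s t \<Psi> \<omega>) (skeleton act E s t \<Psi> \<circ> \<omega>)"
    by (rule local_on_method)
qed

end
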